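(* Let $G$ be a strictly unimodal uniform grid with associated integer $N$. For every $E\subsetneq[0,N]$: (a) $\mathsf{PC}_G(E)=\min\{d\in[0,N]: E \text{ is } d\text{-admitting}\}$; (b) $\mathsf{PPC}_G(E)=|E|-\max\{i\in[0,\lfloor N/2\rfloor]: T_{N,i}\subseteq E\}$.
   Context: For integers $a\le b$, $[a,b]$ denotes the set of integers $t$ with $a\le t\le b$ (and $[a,b]=\emptyset$ if $a>b$); $[n]=[1,n]$. A uniform grid is a set $G=[0,k_1-1]\times\cdots\times[0,k_n-1]\subseteq\mathbb{R}^n$ with $n\ge1$ and integers $k_i\ge2$; put $N=\sum_{i\in[n]}(k_i-1)$. The weight of $x\in G$ is $\mathrm{wt}(x)=\sum_{i\in[n]}x_i$. For $E\subseteq[0,N]$ let $\underline{E}=\{x\in G:\mathrm{wt}(x)\in E\}$, and $\underline{j}=\underline{\{j\}}$. The grid $G$ is strictly unimodal if $|\underline{0}|<|\underline{1}|<\cdots<|\underline{\lfloor N/2\rfloor}|=|\underline{\lceil N/2\rceil}|>\cdots>|\underline{N}|$. For $P\in\mathbb{R}[X_1,\ldots,X_n]$ let $\mathcal{Z}_G(P)=\{a\in G:P(a)=0\}$. For $E\subsetneq[0,N]$, $P$ is a nontrivial polynomial cover of $\underline{E}$ if $\underline{E}\subseteq\mathcal{Z}_G(P)\ne G$; it is a proper polynomial cover of $\underline{E}$ if $\underline{E}\subseteq\mathcal{Z}_G(P)$ and $\underline{j}\not\subseteq\mathcal{Z}_G(P)$ for every $j\in[0,N]\setminus E$. $\mathsf{PC}_G(E)$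 and $\mathsf{PPC}_G(E)$ denote the minimum degree of a nontrivial polynomial cover, respectively of a proper polynomial cover, of $\underline{E}$. For $i\in[0,N]$ let $T_{N,i}=[0,i-1]\cup[N-i+1,N]$ (so $T_{N,0}=\emptyset$). For $d,i\in[0,N]$ with $i\le d$, a set $E\subseteq[0,N]$ is $(d,i)$-admitting if $E\cup T_{N,i}\ne[0,N]$ and $|E\setminus T_{N,i}|\le d-i$. $E$ is $d$-admitting if it is $(d,i)$-admitting for some $i\in[0,d]$. *)

theory Defs
  imports Complex_Main "HOL-Library.FuncSet" "HOL-Library.Poly_Mapping"
begin

text \<open>Polynomials with real coefficients in variables indexed by natural numbers: finitely
  supported maps from monomials (finitely supported exponent vectors) to coefficients.
  The ring structure is the convolution product of \<^theory>\<open>HOL-Library.Poly_Mapping\<close>.\<close>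

type_synonym real_mpoly = "(nat \<Rightarrow>\<^sub>0 nat) \<Rightarrow>\<^sub>0 real"

text \<open>The ring $R[X_1,...,X_n]$.\<close>

definition mpoly_ring :: "nat \<Rightarrow> real_mpoly set" where
  "mpoly_ring n = {P. \<forall>m\<in>Poly_Mapping.keys P. Poly_Mapping.keys m \<subseteq> {1..n}}"

definition eval_mpoly :: "real_mpoly \<Rightarrow> (nat \<Rightarrow> real) \<Rightarrow> real" where
  "eval_mpoly P x =
     (\<Sum>m\<in>Poly_Mapping.keys P. Poly_Mapping.lookup P m *
        (\<Prod>i\<in>Poly_Mapping.keys m. x i ^ Poly_Mapping.lookup m i))"

definition monom_degree :: "(nat \<Rightarrow>\<^sub>0 nat) \<Rightarrow> nat" where
  "monom_degree m = (\<Sum>i\<in>Poly_Mapping.keys m. Poly_Mapping.lookup m i)"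

text \<open>Total degree. The zero polynomial gets degree 0; it is never a nontrivial cover, nor a
  proper cover of a proper subset of the weights, so this convention has no effect below.\<close>

definition total_degree :: "real_mpoly \<Rightarrow> nat" where
  "total_degree P = Max (insert 0 (monom_degree ` Poly_Mapping.keys P))"

text \<open>Points of $R^n$ are functions on \<^term>\<open>{1..n}\<close>, extended by \<^term>\<open>undefined\<close>.\<close>

definition grid :: "nat \<Rightarrow> (nat \<Rightarrow> nat) \<Rightarrow> (nat \<Rightarrow> real) set" where
  "grid n k = (\<Pi>\<^sub>E i\<in>{1..n}. real ` {0..k i - 1})"

definition grid_N :: "nat \<Rightarrow> (nat \<Rightarrow> nat) \<Rightarrow> nat" where
  "grid_N n k = (\<Sum>i\<in>{1..n}. k i - 1)"

definition wt :: "nat \<Rightarrow> (nat \<Rightarrow> real) \<Rightarrow> real" where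
  "wt n x = (\<Sum>i\<in>{1..n}. x i)"

definition layers :: "nat \<Rightarrow> (nat \<Rightarrow> nat) \<Rightarrow> nat set \<Rightarrow> (nat \<Rightarrow> real) set" where
  "layers n k E = {x \<in> grid n k. wt n x \<in> real ` E}"

text \<open>Here \<^term>\<open>N div 2\<close> and \<^term>\<open>(N + 1) div 2\<close> are the floor and the ceiling of $N/2$.\<close>

definition strictly_unimodal :: "nat \<Rightarrow> (nat \<Rightarrow> nat) \<Rightarrow> bool" where
  "strictly_unimodal n k \<longleftrightarrow>
     (let N = grid_N n k; c = (\<lambda>j. card (layers n k {j})) in
        (\<forall>j. j < N div 2 \<longrightarrow> c j < c (j + 1)) \<and>
        c (N div 2) = c ((N + 1) div 2) \<and>
        (\<forall>j. (N + 1) div 2 \<le> j \<and> j < N \<longrightarrow> c j > c (j + 1)))"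

definition zeros_on_grid :: "nat \<Rightarrow> (nat \<Rightarrow> nat) \<Rightarrow> real_mpoly \<Rightarrow> (nat \<Rightarrow> real) set" where
  "zeros_on_grid n k P = {a \<in> grid n k. eval_mpoly P a = 0}"

definition nontrivial_cover :: "nat \<Rightarrow> (nat \<Rightarrow> nat) \<Rightarrow> nat set \<Rightarrow> real_mpoly \<Rightarrow> bool" where
  "nontrivial_cover n k E P \<longleftrightarrow>
     P \<in> mpoly_ring n \<and> layers n k E \<subseteq> zeros_on_grid n k P \<and> zeros_on_grid n k P \<noteq> grid n k"

definition proper_cover :: "nat \<Rightarrow> (nat \<Rightarrow> nat) \<Rightarrow> nat set \<Rightarrow> real_mpoly \<Rightarrow> bool" where
  "proper_cover n k E P \<longleftrightarrow>
     P \<in> mpoly_ring n \<and> layers n k E \<subseteq> zeros_on_grid n k P \<and>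
     (\<forall>j \<in> {0..grid_N n k} - E. \<not> layers n k {j} \<subseteq> zeros_on_grid n k P)"

definition PC :: "nat \<Rightarrow> (nat \<Rightarrow> nat) \<Rightarrow> nat set \<Rightarrow> nat" where
  "PC n k E = (LEAST d. \<exists>P. nontrivial_cover n k E P \<and> total_degree P = d)"

definition PPC :: "nat \<Rightarrow> (nat \<Rightarrow> nat) \<Rightarrow> nat set \<Rightarrow> nat" where
  "PPC n k E = (LEAST d. \<exists>P. proper_cover n k E P \<and> total_degree P = d)"

text \<open>Used only for \<^term>\<open>i \<le> N\<close>. The half-open interval makes the first part empty
  for \<^term>\<open>i = 0\<close>, where \<^term>\<open>{0..i - 1}\<close> would be a singleton by truncated subtraction.\<close>

definition T :: "nat \<Rightarrow> nat \<Rightarrow> nat set" where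
  "T N i = {0..<i} \<union> {N - i + 1..N}"

definition di_admitting :: "nat \<Rightarrow> nat \<Rightarrow> nat \<Rightarrow> nat set \<Rightarrow> bool" where
  "di_admitting N d i E \<longleftrightarrow>
     i \<le> d \<and> E \<union> T N i \<noteq> {0..N} \<and> card (E - T N i) \<le> d - i"

definition d_admitting :: "nat \<Rightarrow> nat \<Rightarrow> nat set \<Rightarrow> bool" where
  "d_admitting N d E \<longleftrightarrow> (\<exists>i\<in>{0..d}. di_admitting N d i E)"

end

(*
  Functions on the grid carry an sl_2-action: raise and lower move weight between adjacent layers,
  they are adjoint for a weighted inner product, and [lower, raise] acts on the layer of weight w
  as N - 2w.

  Lower bounds. Let f have degree d and be nonzero on layer j. The last nonzero p = lower^m f_j is
  primitive of weight i = j - m, and <f, raise^m p> = <p, p> > 0. Up to the factor (N - 2i - t)!,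
  the number <f, raise^t p> is a polynomial in t of degree at most d - i (check it on products of
  binomial coefficients, which span the polynomials). It vanishes at t = e - i whenever f vanishes
  on a layer e with i <= e <= N - i, so there are at most d - i such e. Taking j outside E turns
  this into admissibility, and choosing j extremal gives the bound for proper covers.

  Upper bounds. Strict unimodality gives a primitive p of every weight i <= N/2 by counting
  dimensions. The polynomial sum_a p(a) prod_j binom(x_j, a_j) of degree i restricts to
  raise^(w - i) p / (w - i)! on layer w, hence is zero exactly on the layers in T_{N,i}; the
  remaining layers of E are covered by the factors wt - e.
*)

theory Submission
  imports Defs "HOL-Computational_Algebra.Polynomial"
begin

section \<open>Underdetermined homogeneous linear systems\<close>

text \<open>Gaussian elimination: an equation with a nonzero coefficient at \<open>a0\<close>
  eliminates \<open>a0\<close> from the others, leaving one unknown and one equation fewer.\<close>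

lemma homogeneous_system_nontrivial:
  fixes M :: "'b \<Rightarrow> 'a \<Rightarrow> real"
  assumes "finite C" "finite A" "card C < card A"
  shows "\<exists>c. (\<exists>a\<in>A. c a \<noteq> 0) \<and> (\<forall>b\<in>C. (\<Sum>a\<in>A. M b a * c a) = 0)"
  using assms
proof (induction C arbitrary: A M rule: finite_induct)
  case empty
  then obtain a where "a \<in> A" by fastforce
  then show ?case by (intro exI[of _ "\<lambda>_. 1"]) auto
next
  case (insert b C)
  show ?case
  proof (cases "\<forall>a\<in>A. M b a = 0")
    case True
    have "card C < card A" using insert.prems insert.hyps by simp
    then obtain c where "\<exists>a\<in>A. c a \<noteq> 0" "\<forall>b\<in>C. (\<Sum>a\<in>A. M b a * c a) = 0"
      using insert.IH[of A M] insert.prems by blast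
    then show ?thesis using True by (intro exI[of _ c]) simp
  next
    case False
    then obtain a0 where a0: "a0 \<in> A" "M b a0 \<noteq> 0" by blast
    define A' where "A' = A - {a0}"
    have A: "A = insert a0 A'" "a0 \<notin> A'" "finite A'" using a0 insert.prems by (auto simp: A'_def)
    have "card C < card A'" using insert A by simp
    then obtain c where c: "\<exists>a\<in>A'. c a \<noteq> 0"
      "\<And>b'. b' \<in> C \<Longrightarrow> (\<Sum>a\<in>A'. (M b' a - M b' a0 / M b a0 * M b a) * c a) = 0"
      using insert.IH[of A' "\<lambda>b' a. M b' a - M b' a0 / M b a0 * M b a"] A by auto
    let ?s = "\<Sum>a\<in>A'. M b a * c a"
    \<comment> \<open>The value at \<open>a0\<close> is the one that solves equation
      \<open>b\<close>; inserting it turns every other equation into its eliminated form.\<close>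
    define c' where "c' = c(a0 := - ?s / M b a0)"
    have e: "(\<Sum>a\<in>A. M b' a * c' a) = (\<Sum>a\<in>A'. M b' a * c a) - M b' a0 / M b a0 * ?s" for b'
    proof -
      have "(\<Sum>a\<in>A'. M b' a * c' a) = (\<Sum>a\<in>A'. M b' a * c a)"
        using A by (intro sum.cong) (auto simp: c'_def)
      then show ?thesis using A by (simp add: c'_def)
    qed
    have "(\<Sum>a\<in>A. M b' a * c' a) = 0" if "b' \<in> C" for b'
      using c(2)[OF that] unfolding e
      by (simp add: left_diff_distrib sum_subtractf sum_distrib_left mult.assoc)
    moreover have "(\<Sum>a\<in>A. M b a * c' a) = 0" using a0 by (simp add: e)
    moreover have "\<exists>a\<in>A. c' a \<noteq> 0" using c(1) A by (auto simp: c'_def)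
    ultimately show ?thesis by blast
  qed
qed

section \<open>The action of sl(2) on functions on a box\<close>

locale box =
  fixes I :: "'i set" and r :: "'i \<Rightarrow> nat"
  assumes finite_I: "finite I"
begin

definition B :: "('i \<Rightarrow> nat) set" where
  "B = (\<Pi>\<^sub>E j\<in>I. {..r j})"

definition rank :: "('i \<Rightarrow> nat) \<Rightarrow> nat" where
  "rank x = (\<Sum>j\<in>I. x j)"

definition N :: nat where
  "N = (\<Sum>j\<in>I. r j)"

text \<open>The factors \<^term>\<open>x j\<close> and \<^term>\<open>real (r j) - real (x j)\<close> vanish exactly where the
  shifted point would leave the box; this also neutralises truncated subtraction.\<close>

definition raise :: "(('i \<Rightarrow> nat) \<Rightarrow> real) \<Rightarrow> ('i \<Rightarrow> nat) \<Rightarrow> real" where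
  "raise g x = (\<Sum>j\<in>I. real (x j) * g (x(j := x j - 1)))"

definition lower :: "(('i \<Rightarrow> nat) \<Rightarrow> real) \<Rightarrow> ('i \<Rightarrow> nat) \<Rightarrow> real" where
  "lower g x = (\<Sum>j\<in>I. (real (r j) - real (x j)) * g (x(j := x j + 1)))"

text \<open>Chosen so that \<open>raise\<close> and \<open>lower\<close> become adjoint for
  \<open>inner\<close>.\<close>

definition weight :: "('i \<Rightarrow> nat) \<Rightarrow> real" where
  "weight x = (\<Prod>j\<in>I. real (r j choose x j))"

definition inner :: "(('i \<Rightarrow> nat) \<Rightarrow> real) \<Rightarrow> (('i \<Rightarrow> nat) \<Rightarrow> real) \<Rightarrow> real" where
  "inner f g = (\<Sum>x\<in>B. weight x * f x * g x)"

text \<open>Functions are total but stand for functions on \<open>B\<close>, so conditions are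
  imposed only there. Zero is homogeneous of every weight.\<close>

definition homog :: "nat \<Rightarrow> (('i \<Rightarrow> nat) \<Rightarrow> real) \<Rightarrow> bool" where
  "homog w g \<longleftrightarrow> (\<forall>x\<in>B. g x \<noteq> 0 \<longrightarrow> rank x = w)"

definition zero_on :: "(('i \<Rightarrow> nat) \<Rightarrow> real) \<Rightarrow> bool" where
  "zero_on g \<longleftrightarrow> (\<forall>x\<in>B. g x = 0)"

text \<open>The lowest weight vectors of the action, together with zero.\<close>

definition primitive :: "nat \<Rightarrow> (('i \<Rightarrow> nat) \<Rightarrow> real) \<Rightarrow> bool" where
  "primitive i p \<longleftrightarrow> homog i p \<and> zero_on (lower p)"

section \<open>Points of the box, the inner product and locality of the operators\<close>

lemma finite_B: "finite B"
  unfolding B_def using finite_I by (intro finite_PiE) auto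

lemma B_upd: "x \<in> B \<Longrightarrow> j \<in> I \<Longrightarrow> a \<le> r j \<Longrightarrow> x(j := a) \<in> B"
  by (auto simp: B_def PiE_iff extensional_def)

lemma B_le: "x \<in> B \<Longrightarrow> j \<in> I \<Longrightarrow> x j \<le> r j"
  by (auto simp: B_def)

lemma B_down: "x \<in> B \<Longrightarrow> j \<in> I \<Longrightarrow> x(j := x j - 1) \<in> B"
  using B_le by (intro B_upd) (auto intro: order_trans[OF diff_le_self])

lemma B_up: "x \<in> B \<Longrightarrow> j \<in> I \<Longrightarrow> x j \<noteq> r j \<Longrightarrow> x(j := x j + 1) \<in> B"
  using B_le[of x j] by (intro B_upd) auto

lemma rank_upd: "j \<in> I \<Longrightarrow> rank (x(j := a)) + x j = rank x + a"
  unfolding rank_def by (simp add: sum.remove[OF finite_I, of j])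

lemma weight_pos: "x \<in> B \<Longrightarrow> weight x > 0"
  unfolding weight_def by (intro prod_pos) (auto dest: B_le)

lemma inner_self_pos: assumes "\<not> zero_on g" shows "inner g g > 0"
proof -
  obtain x where x: "x \<in> B" "g x \<noteq> 0" using assms by (auto simp: zero_on_def)
  have "weight x * g x * g x > 0"
    using x weight_pos[of x] by (simp add: mult.assoc zero_less_mult_iff linorder_neq_iff) linarith
  moreover have "weight y * g y * g y \<ge> 0" if "y \<in> B" for y
    using weight_pos[OF that] by (simp add: mult.assoc)
  ultimately show ?thesis unfolding inner_def using x finite_B
    by (intro sum_pos2) auto
qed

lemma inner_zero_right: "zero_on g \<Longrightarrow> inner f g = 0"
  by (auto simp: inner_def zero_on_def)

lemma inner_cong: "(\<And>x. x \<in> B \<Longrightarrow> f x * g x = f' x * g' x) \<Longrightarrow> inner f g = inner f' g'"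
  by (auto simp: inner_def mult.assoc)

lemma inner_scale_right: "inner f (\<lambda>x. c * g x) = c * inner f g"
  by (simp add: inner_def sum_distrib_left mult_ac)

lemma inner_scale_left: "inner (\<lambda>x. c * f x) g = c * inner f g"
  by (simp add: inner_def sum_distrib_left mult_ac)

lemma inner_sum_left: "inner (\<lambda>x. \<Sum>a\<in>A. f a x) g = (\<Sum>a\<in>A. inner (f a) g)"
  unfolding inner_def by (subst sum.swap) (simp add: sum_distrib_left sum_distrib_right)

text \<open>Truncated subtraction leaves \<open>x\<close> unchanged at \<open>x j = 0\<close>, so
  \<open>raise\<close> never looks outside \<open>B\<close>.\<close>

lemma raise_cong:
  "(\<And>y. y \<in> B \<Longrightarrow> f y = g y) \<Longrightarrow> x \<in> B \<Longrightarrow> raise f x = raise g x"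
  unfolding raise_def by (intro sum.cong refl) (simp add: B_down del: One_nat_def)

lemma lower_cong:
  assumes "\<And>y. y \<in> B \<Longrightarrow> f y = g y" "x \<in> B"
  shows "lower f x = lower g x"
  unfolding lower_def
proof (intro sum.cong refl)
  \<comment> \<open>The shifted point leaves \<open>B\<close> only at \<open>x j = r j\<close>,
    where its coefficient is zero.\<close>
  fix j assume "j \<in> I"
  then show "(real (r j) - real (x j)) * f (x(j := x j + 1)) =
      (real (r j) - real (x j)) * g (x(j := x j + 1))"
    using B_up[OF assms(2), of j] assms(1) by (cases "x j = r j") auto
qed

lemma raise_0 [simp]: "raise (\<lambda>_. 0) x = 0"
  by (simp add: raise_def)

lemma raise_scale: "raise (\<lambda>x. c * g x) x = c * raise g x"
  by (simp add: raise_def sum_distrib_left mult_ac)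

lemma zero_on_lower: "zero_on g \<Longrightarrow> zero_on (lower g)"
  using lower_cong[of g "\<lambda>_. 0"] by (auto simp: zero_on_def lower_def)

section \<open>Adjointness and the commutator\<close>

text \<open>Binomial absorption in the \<open>j\<close>-th factor, the other factors being equal;
  adjointness rests on it.\<close>

lemma weight_shift:
  assumes "j \<in> I"
  shows "weight x * (real (r j) - real (x j)) = weight (x(j := x j + 1)) * real (x j + 1)"
proof -
  have "real (r j choose x j) * (real (r j) - real (x j)) = real (r j choose Suc (x j)) * real (Suc (x j))"
  proof (cases "x j \<le> r j")
    case True
    have "real ((r j - x j) * (r j choose x j)) = real (Suc (x j) * (r j choose Suc (x j)))"
      by (simp only: binomial_absorb_comp binomial_absorption)
    then show ?thesis using True by (simp add: of_nat_diff algebra_simps)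
  next
    case False then show ?thesis by (simp add: binomial_eq_0)
  qed
  moreover have "weight x = real (r j choose x j) * (\<Prod>l\<in>I - {j}. real (r l choose x l))"
    unfolding weight_def using assms finite_I by (simp add: prod.remove)
  moreover have "weight (x(j := x j + 1)) =
      real (r j choose Suc (x j)) * (\<Prod>l\<in>I - {j}. real (r l choose x l))"
    unfolding weight_def using assms finite_I by (simp add: prod.remove[of I j])
  ultimately show ?thesis by simp
qed

text \<open>Adjointness holds coordinate by coordinate, by substituting
  \<open>y = x(j := x j + 1)\<close> and applying \<open>weight_shift\<close>.\<close>

lemma inner_lower: "inner f (lower h) = inner (raise f) h"
proof -
  have "(\<Sum>x\<in>B. weight x * f x * ((real (r j) - real (x j)) * h (x(j := x j + 1)))) =
      (\<Sum>y\<in>B. weight y * (real (y j) * f (y(j := y j - 1))) * h y)" if j: "j \<in> I" for j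
  proof -
    \<comment> \<open>Points with \<open>x j = r j\<close> contribute zero; the shift maps the
      others bijectively onto the points with \<open>y j \<noteq> 0\<close>.\<close>
    have "(\<Sum>x\<in>B. weight x * f x * ((real (r j) - real (x j)) * h (x(j := x j + 1)))) =
        (\<Sum>x\<in>{x\<in>B. x j \<noteq> r j}. weight x * f x * ((real (r j) - real (x j)) * h (x(j := x j + 1))))"
      using finite_B by (intro sum.mono_neutral_right) auto
    also have "\<dots> = (\<Sum>y\<in>{y\<in>B. y j \<noteq> 0}. weight y * (real (y j) * f (y(j := y j - 1))) * h y)"
    proof (rule sum.reindex_bij_witness[where i = "\<lambda>y. y(j := y j - 1)" and j = "\<lambda>x. x(j := x j + 1)"], goal_cases)
      case (1 x) then show ?case by simp
    next
      case (2 x) then show ?case using B_up j by auto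
    next
      case (3 y) then show ?case by simp
    next
      case (4 y) then show ?case using B_down[of y j] B_le[of y j] j by auto
    next
      case (5 x)
      have "weight x * (real (r j) - real (x j)) = weight (x(j := x j + 1)) * real (x j + 1)"
        using weight_shift j by blast
      then show ?case by (simp add: mult_ac)
    qed
    also have "\<dots> = (\<Sum>y\<in>B. weight y * (real (y j) * f (y(j := y j - 1))) * h y)"
      using finite_B by (intro sum.mono_neutral_left) auto
    finally show ?thesis .
  qed
  then have "(\<Sum>j\<in>I. \<Sum>x\<in>B. weight x * f x * ((real (r j) - real (x j)) * h (x(j := x j + 1)))) =
      (\<Sum>j\<in>I. \<Sum>y\<in>B. weight y * (real (y j) * f (y(j := y j - 1))) * h y)"
    by (rule sum.cong[OF refl])
  then show ?thesis
    unfolding inner_def lower_def raise_def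
    by (simp only: sum_distrib_left sum_distrib_right sum.swap[of _ B I])
qed

lemma inner_commute: "inner f g = inner g f"
  by (simp add: inner_def mult_ac)

lemma inner_lower_funpow: "inner f ((raise ^^ m) h) = inner ((lower ^^ m) f) h"
proof (induction m arbitrary: h)
  case (Suc m)
  have "inner f ((raise ^^ Suc m) h) = inner f ((raise ^^ m) (raise h))"
    by (simp only: funpow_Suc_right comp_apply)
  also have "\<dots> = inner (raise h) ((lower ^^ m) f)" using Suc by (simp add: inner_commute)
  also have "\<dots> = inner h (lower ((lower ^^ m) f))" by (simp add: inner_lower)
  finally show ?case by (simp add: inner_commute)
qed simp

text \<open>Shifts in different coordinates commute. The terms with \<open>l = j\<close> differ by
  \<open>(r - x) * (x + 1) - x * (r - x + 1) = r - 2 * x\<close>, which sums to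
  \<open>N - 2 * rank x\<close>.\<close>

lemma commutator:
  "lower (raise g) x = raise (lower g) x + (real N - 2 * real (rank x)) * g x"
proof -
  let ?P = "\<lambda>j l. (real (r j) - real (x j)) * (real ((x(j := x j + 1)) l) *
      g ((x(j := x j + 1))(l := (x(j := x j + 1)) l - 1)))"
  let ?Q = "\<lambda>j l. real (x l) * ((real (r j) - real ((x(l := x l - 1)) j)) *
      g ((x(l := x l - 1))(j := (x(l := x l - 1)) j + 1)))"
  have e: "?P j l = ?Q j l + (if l = j then (real (r j) - 2 * real (x j)) * g x else 0)" for j l
  proof (cases "l = j")
    case True
    show ?thesis
    proof (cases "x j")
      \<comment> \<open>Going down and then up does not return to \<open>x\<close> here, but that
        term carries the factor \<open>x j = 0\<close>.\<close>
      case 0 then show ?thesis using True by (simp add: fun_upd_idem)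
    next
      case (Suc a)
      then have "x(j := Suc a) = x" by (simp add: fun_upd_idem)
      then show ?thesis using True Suc by (simp add: algebra_simps)
    qed
  next
    case False
    then show ?thesis by (simp add: fun_upd_twist[of l j])
  qed
  have "lower (raise g) x = (\<Sum>j\<in>I. \<Sum>l\<in>I. ?P j l)"
    by (simp add: lower_def raise_def sum_distrib_left)
  also have "\<dots> = (\<Sum>j\<in>I. \<Sum>l\<in>I. ?Q j l) + (\<Sum>j\<in>I. (real (r j) - 2 * real (x j)) * g x)"
    unfolding e sum.distrib using finite_I by simp
  also have "(\<Sum>j\<in>I. \<Sum>l\<in>I. ?Q j l) = raise (lower g) x"
    by (subst sum.swap) (simp add: lower_def raise_def sum_distrib_left)
  also have "(\<Sum>j\<in>I. (real (r j) - 2 * real (x j)) * g x) = (real N - 2 * real (rank x)) * g x"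
    by (simp add: N_def rank_def sum_distrib_right[symmetric] sum_subtractf sum_distrib_left[symmetric])
  finally show ?thesis .
qed

section \<open>Grading by rank\<close>

lemma homog_raise: assumes "homog w g" shows "homog (Suc w) (raise g)"
  unfolding homog_def
proof (intro ballI impI)
  fix x assume x: "x \<in> B" "raise g x \<noteq> 0"
  then obtain j where "j \<in> I" "real (x j) * g (x(j := x j - 1)) \<noteq> 0"
    unfolding raise_def by (meson sum.not_neutral_contains_not_neutral)
  then have j: "j \<in> I" "x j \<noteq> 0" "g (x(j := x j - 1)) \<noteq> 0" by auto
  then have "rank (x(j := x j - 1)) = w" using assms B_down x by (auto simp: homog_def)
  then show "rank x = Suc w" using rank_upd[OF j(1), of x "x j - 1"] j by simp
qed

lemma homog_raise_funpow: "homog w g \<Longrightarrow> homog (w + t) ((raise ^^ t) g)"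
  by (induction t) (auto dest: homog_raise)

lemma lower_nonzeroD:
  assumes "homog w g" "x \<in> B" "lower g x \<noteq> 0"
  shows "Suc (rank x) = w"
proof -
  obtain j where "j \<in> I" "(real (r j) - real (x j)) * g (x(j := x j + 1)) \<noteq> 0"
    using assms(3) unfolding lower_def by (meson sum.not_neutral_contains_not_neutral)
  then have j: "j \<in> I" "x j \<noteq> r j" "g (x(j := x j + 1)) \<noteq> 0" by auto
  then have "rank (x(j := x j + 1)) = w" using assms B_up by (auto simp: homog_def)
  then show ?thesis using rank_upd[OF j(1), of x "x j + 1"] j by simp
qed

lemma homog_lower: "homog (Suc w) g \<Longrightarrow> homog w (lower g)"
  unfolding homog_def[of w] by (blast dest: lower_nonzeroD Suc_inject)

lemma homog_lower_0: "homog 0 g \<Longrightarrow> zero_on (lower g)"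
  unfolding zero_on_def by (blast dest: lower_nonzeroD)

lemma homog_lower_funpow: "homog w g \<Longrightarrow> t \<le> w \<Longrightarrow> homog (w - t) ((lower ^^ t) g)"
proof (induction t)
  case (Suc t)
  then have "homog (Suc (w - Suc t)) ((lower ^^ t) g)" by (simp add: Suc_diff_Suc)
  then show ?case by (simp add: homog_lower)
qed simp

section \<open>Strings generated by primitive functions\<close>

text \<open>Moving \<open>lower\<close> past all the raises ends in \<open>lower p = 0\<close> and
  collects \<open>N - 2 * (i + s)\<close> for each \<open>s \<le> t\<close>; these sum to
  \<open>(t + 1) * (N - 2 * i - t)\<close>.\<close>

lemma lower_raise_primitive:
  assumes "primitive i p" "x \<in> B"
  shows "lower ((raise ^^ Suc t) p) x =
    real (Suc t) * (real N - 2 * real i - real t) * (raise ^^ t) p x"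
  using assms(2)
proof (induction t arbitrary: x)
  case 0
  have "raise (lower p) x = raise (\<lambda>_. 0) x"
    using assms 0 by (intro raise_cong) (auto simp: primitive_def zero_on_def)
  moreover have "p x \<noteq> 0 \<longrightarrow> rank x = i" using assms(1) 0 by (auto simp: primitive_def homog_def)
  ultimately show ?case by (auto simp: commutator)
next
  case (Suc t)
  let ?g = "(raise ^^ Suc t) p"
  let ?c = "real (Suc t) * (real N - 2 * real i - real t)"
  have "homog (i + Suc t) ?g" using assms(1) homog_raise_funpow unfolding primitive_def by blast
  then have g: "?g x \<noteq> 0 \<longrightarrow> rank x = i + Suc t" using Suc.prems by (auto simp: homog_def)
  have "raise (lower ?g) x = raise (\<lambda>y. ?c * (raise ^^ t) p y) x"
    using Suc.IH Suc.prems by (rule raise_cong)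
  also have "\<dots> = ?c * ?g x" by (simp add: raise_scale)
  finally have "lower (raise ?g) x = ?c * ?g x + (real N - 2 * real (rank x)) * ?g x"
    by (simp only: commutator)
  \<comment> \<open>The rank is known to be \<open>i + Suc t\<close> only where \<open>?g\<close> is
    nonzero; elsewhere both sides vanish.\<close>
  also have "\<dots> = real (Suc (Suc t)) * (real N - 2 * real i - real (Suc t)) * ?g x"
  proof (cases "?g x = 0")
    case False
    then have "rank x = i + Suc t" using g by blast
    then show ?thesis by (simp only: of_nat_add of_nat_Suc) (simp only: algebra_simps; simp)
  qed (simp only: mult_zero_right add_0)
  finally show ?case by (simp only: funpow.simps comp_apply)
qed

text \<open>By adjointness \<open>inner (raise p) (raise p) = (N - 2 * i) * inner p p\<close>, which
  cannot be negative.\<close>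

lemma primitive_rank_le:
  assumes "primitive i p" "\<not> zero_on p"
  shows "2 * i \<le> N"
proof (rule ccontr)
  assume "\<not> 2 * i \<le> N"
  then have neg: "real N - 2 * real i < 0" by linarith
  have "inner (raise p) (raise p) = inner p (lower (raise p))" by (simp add: inner_lower)
  also have "\<dots> = inner p (\<lambda>x. (real N - 2 * real i) * p x)"
    using lower_raise_primitive[OF assms(1), of _ 0] by (intro inner_cong) auto
  also have "\<dots> < 0"
    using inner_self_pos[OF assms(2)] neg by (simp add: inner_scale_right mult_neg_pos)
  finally have "inner (raise p) (raise p) < 0" .
  moreover have "inner (raise p) (raise p) \<ge> 0"
    using inner_self_pos[of "raise p"] inner_zero_right[of "raise p"] by (cases "zero_on (raise p)") auto
  ultimately show False by simp
qed

text \<open>At \<open>t = N - 2 * i\<close> the coefficient in \<open>lower_raise_primitive\<close>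
  is zero, so the next power has norm zero by adjointness, and later powers stay zero.\<close>

lemma raise_primitive_zero:
  assumes "primitive i p" "\<not> zero_on p" "t > N - 2 * i"
  shows "zero_on ((raise ^^ t) p)"
proof -
  let ?M = "N - 2 * i"
  have M: "real N - 2 * real i - real ?M = 0" using primitive_rank_le[OF assms(1,2)] by simp
  let ?g = "(raise ^^ Suc ?M) p"
  have "inner ?g ?g = inner ((raise ^^ ?M) p) (lower ?g)" by (simp add: inner_lower)
  also have "\<dots> = 0"
    using lower_raise_primitive[OF assms(1), of _ ?M] M
    by (intro inner_zero_right) (auto simp: zero_on_def)
  finally have "zero_on ?g" using inner_self_pos[of ?g] by fastforce
  then have "zero_on ((raise ^^ (s + Suc ?M)) p)" for s
  proof (induction s)
    case (Suc s)
    then have "raise ((raise ^^ (s + Suc ?M)) p) x = raise (\<lambda>_. 0) x" if "x \<in> B" for x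
      using that by (intro raise_cong) (auto simp: zero_on_def)
    then show ?case by (simp add: zero_on_def)
  qed simp
  from this[of "t - Suc ?M"] show ?thesis using assms(3) by simp
qed

text \<open>Before the end of the string, \<open>lower\<close> maps each power back to a nonzero
  multiple of the preceding one.\<close>

lemma raise_primitive_nonzero:
  assumes "primitive i p" "\<not> zero_on p" "t \<le> N - 2 * i"
  shows "\<not> zero_on ((raise ^^ t) p)"
  using assms(3)
proof (induction t)
  case (Suc t)
  have "real N - 2 * real i - real t \<noteq> 0" using Suc.prems by linarith
  moreover have "zero_on (lower ((raise ^^ Suc t) p))" if "zero_on ((raise ^^ Suc t) p)"
    using that by (rule zero_on_lower)
  ultimately show ?case
    using Suc lower_raise_primitive[OF assms(1), of _ t] by (auto simp: zero_on_def)
qed (use assms in simp)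

subsection \<open>Pairing polynomials with primitive functions\<close>

text \<open>This basis of the polynomials replaces the monomials because \<open>raise\<close> acts
  on it by a scalar on each layer.\<close>

definition binom :: "('i \<Rightarrow> nat) \<Rightarrow> ('i \<Rightarrow> nat) \<Rightarrow> real" where
  "binom a x = (\<Prod>j\<in>I. real (x j choose a j))"

lemma binom_nonzeroD:
  assumes "binom a x \<noteq> 0" shows "\<And>j. j \<in> I \<Longrightarrow> a j \<le> x j" and "rank a \<le> rank x"
proof -
  show le: "a j \<le> x j" if "j \<in> I" for j
    using assms that finite_I by (auto simp: binom_def prod_zero_iff binomial_eq_0_iff not_less)
  show "rank a \<le> rank x" unfolding rank_def using le by (intro sum_mono)
qed

text \<open>Each coordinate contributes
  \<open>x * (x - 1 choose a) = (x - a) * (x choose a)\<close>, and the factors \<open>x - a\<close>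
  add up to the difference of ranks.\<close>

lemma raise_binom: "raise (binom a) x = (real (rank x) - real (rank a)) * binom a x"
proof -
  have "real (x j) * binom a (x(j := x j - 1)) = (real (x j) - real (a j)) * binom a x"
    if j: "j \<in> I" for j
  proof -
    have "real (x j) * real (x j - 1 choose a j) = (real (x j) - real (a j)) * real (x j choose a j)"
    proof (cases "a j \<le> x j")
      case True
      have "real ((x j - a j) * (x j choose a j)) = real (x j * (x j - 1 choose a j))"
        using binomial_absorb_comp[of "x j" "a j"] by (simp only:)
      then show ?thesis using True by (simp add: of_nat_diff)
    next
      case False then show ?thesis by (simp add: binomial_eq_0)
    qed
    moreover have "binom a x = real (x j choose a j) * (\<Prod>l\<in>I - {j}. real (x l choose a l))"
      unfolding binom_def using j finite_I by (simp add: prod.remove)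
    moreover have "binom a (x(j := x j - 1)) =
        real (x j - 1 choose a j) * (\<Prod>l\<in>I - {j}. real (x l choose a l))"
      unfolding binom_def using j finite_I by (simp add: prod.remove[of I j])
    ultimately show ?thesis by simp
  qed
  then show ?thesis
    by (simp add: raise_def rank_def sum_distrib_right[symmetric] sum_subtractf)
qed

text \<open>Two evaluations of one pairing: \<open>lower\<close> is moved to the left, where it
  becomes \<open>raise\<close> and scales \<open>binom a\<close>, or it is applied on the right. The
  result is a recurrence in \<open>t\<close>.\<close>

lemma inner_binom_raise_Suc:
  assumes "primitive i p"
  shows "(real (i + Suc t) - real (rank a)) * inner (binom a) ((raise ^^ Suc t) p) =
    real (Suc t) * (real N - 2 * real i - real t) * inner (binom a) ((raise ^^ t) p)"
proof -
  let ?g = "(raise ^^ Suc t) p"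
  have g: "homog (i + Suc t) ?g"
    using assms homog_raise_funpow unfolding primitive_def by blast
  have "inner (binom a) (lower ?g) = inner (raise (binom a)) ?g" by (rule inner_lower)
  also have "\<dots> = inner (\<lambda>x. (real (i + Suc t) - real (rank a)) * binom a x) ?g"
  proof (rule inner_cong)
    fix x assume "x \<in> B"
    then have "?g x = 0 \<or> rank x = i + Suc t" using g unfolding homog_def by blast
    then show "raise (binom a) x * ?g x = (real (i + Suc t) - real (rank a)) * binom a x * ?g x"
      unfolding raise_binom by (elim disjE) simp_all
  qed
  also have "\<dots> = (real (i + Suc t) - real (rank a)) * inner (binom a) ?g" by (rule inner_scale_left)
  also have "inner (binom a) (lower ?g) = inner (binom a)
      (\<lambda>x. real (Suc t) * (real N - 2 * real i - real t) * (raise ^^ t) p x)"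
    using lower_raise_primitive[OF assms] by (intro inner_cong) (simp only:)
  finally show ?thesis by (simp only: inner_scale_right)
qed

lemma inner_binom_primitive:
  assumes "primitive i p"
  shows "(real i - real (rank a)) * inner (binom a) p = 0"
proof -
  have "0 = inner (binom a) (lower p)" using assms by (simp add: primitive_def inner_zero_right)
  also have "\<dots> = inner (raise (binom a)) p" by (rule inner_lower)
  also have "\<dots> = inner (\<lambda>x. (real i - real (rank a)) * binom a x) p"
    using assms by (intro inner_cong) (auto simp: raise_binom primitive_def homog_def)
  finally show ?thesis by (simp add: inner_scale_left)
qed

lemma inner_binom_zero:
  assumes "homog w g" "w < rank a"
  shows "inner (binom a) g = 0"
proof -
  have "binom a x * g x = 0" if "x \<in> B" for x
    using assms that binom_nonzeroD(2)[of a x] unfolding homog_def by (metis mult_eq_0_iff not_le)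
  then show ?thesis unfolding inner_def by (intro sum.neutral) (simp add: mult.assoc)
qed

text \<open>With \<open>s = rank a - i\<close>, the pairings vanish for \<open>t < s\<close>; the
  recurrence then makes the left side proportional to \<open>t choose s\<close>, with the constant
  read off at \<open>t = s\<close>. If \<open>s > N - 2 * i\<close>, the truncated factorial
  argument is harmless, since \<open>t choose s\<close> is zero.\<close>

lemma inner_binom_raise_primitive:
  assumes p: "primitive i p" and nz: "\<not> zero_on p" and le: "i \<le> rank a" "t \<le> N - 2 * i"
  shows "inner (binom a) ((raise ^^ t) p) * fact (N - 2 * i - t) =
    inner (binom a) ((raise ^^ (rank a - i)) p) * fact (N - 2 * i - (rank a - i)) *
      real (t choose (rank a - i))"
  using le(2)
proof (induction t)
  case 0
  show ?case
  proof (cases "rank a = i")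
    case True
    then show ?thesis by simp
  next
    case False
    then show ?thesis using inner_binom_primitive[OF p, of a] le by simp
  qed
next
  case (Suc t)
  let ?s = "rank a - i" and ?M = "N - 2 * i"
  let ?l = "\<lambda>t. inner (binom a) ((raise ^^ t) p)"
  let ?K = "?l ?s * fact (?M - ?s)"
  consider "Suc t < ?s" | "Suc t = ?s" | "?s \<le> t" by linarith
  then show ?case
  proof cases
    case 1
    have "homog (i + Suc t) ((raise ^^ Suc t) p)"
      using p homog_raise_funpow unfolding primitive_def by blast
    then have "?l (Suc t) = 0" using 1 by (intro inner_binom_zero) auto
    then show ?thesis using 1 by (simp only: binomial_eq_0 of_nat_0 mult_zero_left mult_zero_right)
  next
    case 2
    show ?thesis unfolding 2 by simp
  next
    case 3
    have ts: "real (i + Suc t) - real (rank a) = real (Suc t - ?s)"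
      using 3 le(1) by (simp add: of_nat_diff)
    have M: "real N - 2 * real i - real t = real (?M - t)"
      using primitive_rank_le[OF p nz] Suc.prems by (simp add: of_nat_diff)
    have f: "fact (?M - t) = real (?M - t) * fact (?M - Suc t)"
      using Suc.prems by (subst fact_reduce) auto
    have b: "real (Suc t - ?s) * real (Suc t choose ?s) = real (Suc t) * real (t choose ?s)"
      by (simp only: of_nat_mult[symmetric] binomial_absorb_comp diff_Suc_1)
    have "real (Suc t - ?s) * (?l (Suc t) * fact (?M - Suc t)) =
        real (Suc t) * (?l t * (real (?M - t) * fact (?M - Suc t)))"
      using inner_binom_raise_Suc[OF p, of t a] unfolding ts M
      by (simp only: mult.assoc[symmetric]) (simp only: mult_ac)
    also have "\<dots> = real (Suc t) * (?K * real (t choose ?s))"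
      using Suc by (simp only: f[symmetric] Suc_leD)
    also have "\<dots> = real (Suc t - ?s) * (?K * real (Suc t choose ?s))"
      by (simp only: mult.left_commute[of _ ?K] b)
    finally have "real (Suc t - ?s) * (?l (Suc t) * fact (?M - Suc t)) =
        real (Suc t - ?s) * (?K * real (Suc t choose ?s))" .
    moreover have "real (Suc t - ?s) \<noteq> 0" using 3 by simp
    ultimately show ?thesis using mult_left_cancel[of "real (Suc t - ?s)"] by blast
  qed
qed

lemma choose_poly: "\<exists>q :: real poly. degree q \<le> s \<and> (\<forall>t. real (t choose s) = poly q (real t))"
proof (intro exI conjI allI)
  let ?q = "smult (1 / fact s) (\<Prod>u=0..<s. [:- real u, 1:])"
  show "degree ?q \<le> s"
    using degree_prod_sum_le[of "{0..<s}" "\<lambda>u. [:- real u, 1:]"] by simp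
  show "real (t choose s) = poly ?q (real t)" for t
    by (simp add: binomial_gbinomial gbinomial_prod_rev poly_prod)
qed

text \<open>The alternative \<open>q = 0\<close> covers \<open>rank a < i\<close>, where all
  pairings vanish; the additive bound avoids truncated subtraction.\<close>

lemma inner_binom_poly:
  assumes "primitive i p" "\<not> zero_on p"
  obtains q :: "real poly" where "q = 0 \<or> degree q + i \<le> rank a"
    "\<And>t. t \<le> N - 2 * i \<Longrightarrow> inner (binom a) ((raise ^^ t) p) * fact (N - 2 * i - t) = poly q (real t)"
proof (cases "i \<le> rank a")
  case True
  let ?c = "inner (binom a) ((raise ^^ (rank a - i)) p) * fact (N - 2 * i - (rank a - i))"
  obtain q :: "real poly" where q: "degree q \<le> rank a - i"
    "\<And>t. real (t choose (rank a - i)) = poly q (real t)" using choose_poly by blast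
  show ?thesis
  proof (rule that)
    show "smult ?c q = 0 \<or> degree (smult ?c q) + i \<le> rank a"
      using q(1) True by auto
    show "inner (binom a) ((raise ^^ t) p) * fact (N - 2 * i - t) = poly (smult ?c q) (real t)"
      if "t \<le> N - 2 * i" for t
      using inner_binom_raise_primitive[OF assms True that] by (simp only: q(2) poly_smult)
  qed
next
  case False
  \<comment> \<open>The left coefficient of the recurrence is never zero for
    \<open>rank a < i\<close>, so the zero at \<open>t = 0\<close> propagates.\<close>
  have "inner (binom a) ((raise ^^ t) p) = 0" for t
  proof (induction t)
    case 0
    then show ?case using inner_binom_primitive[OF assms(1), of a] False by simp
  next
    case (Suc t)
    moreover have "real (i + Suc t) - real (rank a) \<noteq> 0" using False by linarith
    ultimately show ?case using inner_binom_raise_Suc[OF assms(1), of t a] by (metis mult_eq_0_iff)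
  qed
  then show ?thesis by (intro that[of 0]) auto
qed

lemma inner_poly:
  assumes "primitive i p" "\<not> zero_on p" and S: "finite S" "\<And>s. s \<in> S \<Longrightarrow> rank (a s) \<le> d"
    and f: "\<And>x. x \<in> B \<Longrightarrow> f x = (\<Sum>s\<in>S. c s * binom (a s) x)"
  obtains q :: "real poly" where "q = 0 \<or> degree q + i \<le> d"
    "\<And>t. t \<le> N - 2 * i \<Longrightarrow> inner f ((raise ^^ t) p) * fact (N - 2 * i - t) = poly q (real t)"
proof -
  have "\<exists>q :: real poly. (q = 0 \<or> degree q + i \<le> rank (a s)) \<and> (\<forall>t \<le> N - 2 * i.
      inner (binom (a s)) ((raise ^^ t) p) * fact (N - 2 * i - t) = poly q (real t))" for s
    using inner_binom_poly[OF assms(1,2), of "a s"] by metis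
  then obtain q :: "_ \<Rightarrow> real poly" where q: "\<And>s. q s = 0 \<or> degree (q s) + i \<le> rank (a s)"
    "\<And>s t. t \<le> N - 2 * i \<Longrightarrow>
      inner (binom (a s)) ((raise ^^ t) p) * fact (N - 2 * i - t) = poly (q s) (real t)"
    by metis
  let ?q = "\<Sum>s\<in>S. smult (c s) (q s)"
  show ?thesis
  proof (rule that[of ?q])
    show "?q = 0 \<or> degree ?q + i \<le> d"
    proof (cases "i \<le> d")
      case True
      have "degree (smult (c s) (q s)) \<le> d - i" if "s \<in> S" for s
        using q(1)[of s] S(2)[OF that] degree_smult_le[of "c s" "q s"] by auto
      then have "degree ?q \<le> d - i" using S(1) by (intro degree_sum_le) auto
      then show ?thesis using True by linarith
    next
      case False
      then have "q s = 0" if "s \<in> S" for s using q(1)[of s] S(2)[OF that] by linarith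
      then show ?thesis by simp
    qed
    fix t assume t: "t \<le> N - 2 * i"
    have "inner f ((raise ^^ t) p) = inner (\<lambda>x. \<Sum>s\<in>S. c s * binom (a s) x) ((raise ^^ t) p)"
      using f by (intro inner_cong) simp
    also have "\<dots> = (\<Sum>s\<in>S. c s * inner (binom (a s)) ((raise ^^ t) p))"
      by (simp only: inner_sum_left inner_scale_left)
    finally show "inner f ((raise ^^ t) p) * fact (N - 2 * i - t) = poly ?q (real t)"
      using q(2)[OF t] by (simp add: sum_distrib_right poly_sum mult.assoc)
  qed
qed

text \<open>Common source of both lower bounds: the pairings of \<open>f\<close> with a string give
  a nonzero polynomial of degree at most \<open>d - i\<close>, with a root for every layer of
  \<open>E\<close> that the string meets.\<close>

lemma card_vanishing_ranks:
  assumes S: "finite S" "\<And>s. s \<in> S \<Longrightarrow> rank (a s) \<le> d"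
    and f: "\<And>x. x \<in> B \<Longrightarrow> f x = (\<Sum>s\<in>S. c s * binom (a s) x)"
    and E: "\<And>x. x \<in> B \<Longrightarrow> rank x \<in> E \<Longrightarrow> f x = 0"
    and y: "y \<in> B" "f y \<noteq> 0"
  obtains i where "i \<le> d" "i \<le> rank y" "rank y + i \<le> N" "card (E \<inter> {i..N - i}) \<le> d - i"
proof -
  let ?j = "rank y"
  \<comment> \<open>The component of \<open>f\<close> on the layer of \<open>y\<close>. Lowering it
    \<open>Suc ?j\<close> times gives zero, so a last nonzero power \<open>m\<close> exists.\<close>
  define g where "g x = (if rank x = ?j then f x else 0)" for x
  have gh: "homog ?j g" by (auto simp: homog_def g_def)
  have "zero_on ((lower ^^ Suc ?j) g)"
    using homog_lower_funpow[OF gh, of ?j] homog_lower_0 by simp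
  moreover have "\<not> zero_on ((lower ^^ 0) g)" using y by (auto simp: zero_on_def g_def)
  ultimately obtain m where m: "m < Suc ?j" "\<not> zero_on ((lower ^^ m) g)" "zero_on ((lower ^^ Suc m) g)"
    using ex_least_nat_less[of "\<lambda>m. zero_on ((lower ^^ m) g)" "Suc ?j"] by auto
  define i where "i = ?j - m"
  define p where "p = (lower ^^ m) g"
  have p: "primitive i p" "\<not> zero_on p"
    using homog_lower_funpow[OF gh, of m] m by (auto simp: primitive_def i_def p_def)
  let ?M = "N - 2 * i"
  have M: "2 * i \<le> N" by (rule primitive_rank_le[OF p])
  have h: "homog (i + t) ((raise ^^ t) p)" for t
    using p homog_raise_funpow unfolding primitive_def by blast
  \<comment> \<open>\<open>(raise ^^ m) p\<close> lives on layer \<open>?j\<close>, where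
    \<open>f\<close> and \<open>g\<close> agree; adjointness then produces the norm of
    \<open>p\<close>.\<close>
  have "inner f ((raise ^^ m) p) = inner g ((raise ^^ m) p)"
    using h[of m] m(1) by (intro inner_cong) (auto simp: homog_def g_def i_def)
  also have "\<dots> = inner p p" by (simp add: inner_lower_funpow p_def)
  finally have pos: "inner f ((raise ^^ m) p) > 0" using inner_self_pos[OF p(2)] by simp
  \<comment> \<open>Beyond \<open>?M\<close> the power of \<open>raise\<close> would vanish on
    \<open>B\<close>. The bound yields \<open>?j + i \<le> N\<close>.\<close>
  then have mM: "m \<le> ?M"
    using raise_primitive_zero[OF p, of m] inner_zero_right[of "(raise ^^ m) p" f] by force
  obtain q :: "real poly" where q: "q = 0 \<or> degree q + i \<le> d"
    "\<And>t. t \<le> ?M \<Longrightarrow> inner f ((raise ^^ t) p) * fact (?M - t) = poly q (real t)"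
    using inner_poly[OF p S f] by metis
  have q0: "q \<noteq> 0" using q(2)[OF mM] pos by auto
  have "poly q (real (w - i)) = 0" if w: "w \<in> E \<inter> {i..N - i}" for w
  proof -
    have "f x * (raise ^^ (w - i)) p x = 0" if "x \<in> B" for x
      using h[of "w - i"] E[of x] w that by (auto simp: homog_def)
    then have "inner f ((raise ^^ (w - i)) p) = 0"
      unfolding inner_def by (intro sum.neutral) (simp add: mult.assoc)
    moreover have "w - i \<le> ?M" using w by auto
    ultimately show ?thesis using q(2)[of "w - i"] by simp
  qed
  then have "(\<lambda>w. real (w - i)) ` (E \<inter> {i..N - i}) \<subseteq> {x. poly q x = 0}" by auto
  then have "card ((\<lambda>w. real (w - i)) ` (E \<inter> {i..N - i})) \<le> card {x. poly q x = 0}"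
    using q0 by (intro card_mono poly_roots_finite)
  moreover have "inj_on (\<lambda>w. real (w - i)) (E \<inter> {i..N - i})" by (auto simp: inj_on_def)
  ultimately have "card (E \<inter> {i..N - i}) \<le> degree q"
    using card_poly_roots_bound[OF q0] by (metis card_image order_trans)
  then have "card (E \<inter> {i..N - i}) \<le> d - i" "i \<le> d" using q q0 by auto
  moreover have "i \<le> ?j" "?j + i \<le> N" using m mM M unfolding i_def by linarith+
  ultimately show ?thesis using that by blast
qed

subsection \<open>Polynomials from primitive functions\<close>

text \<open>On layer \<open>i\<close>, \<open>lower p = 0\<close> is a linear system with more
  unknowns than equations. The form \<open>Suc (rank x) = i\<close> makes the layer below empty for
  \<open>i = 0\<close>.\<close>

lemma exists_primitive:
  assumes "card {x \<in> B. Suc (rank x) = i} < card {x \<in> B. rank x = i}"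
  obtains p where "primitive i p" "\<not> zero_on p"
proof -
  let ?A = "{x \<in> B. rank x = i}" and ?C = "{x \<in> B. Suc (rank x) = i}"
  \<comment> \<open>\<open>?M\<close> is the matrix of \<open>lower\<close> from layer \<open>i\<close> to layer \<open>i - 1\<close>.\<close>
  let ?M = "\<lambda>y x. \<Sum>j\<in>I. (real (r j) - real (y j)) * of_bool (y(j := y j + 1) = x)"
  obtain c where c: "\<exists>x\<in>?A. c x \<noteq> 0" "\<And>y. y \<in> ?C \<Longrightarrow> (\<Sum>x\<in>?A. ?M y x * c x) = 0"
    using homogeneous_system_nontrivial[of ?C ?A ?M] finite_B assms by auto
  define p where "p x = (if x \<in> ?A then c x else 0)" for x
  have h: "homog i p" by (auto simp: homog_def p_def)
  have "lower p y = 0" if y: "y \<in> B" for y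
  proof (cases "Suc (rank y) = i")
    case True
    have "p z = (\<Sum>x\<in>?A. of_bool (z = x) * c x)" for z
    proof -
      have "(\<Sum>x\<in>?A. of_bool (z = x) * c x) = (\<Sum>x\<in>?A. if z = x then c x else 0)"
        by (intro sum.cong) auto
      then show ?thesis using finite_B by (simp add: p_def)
    qed
    then have "lower p y = (\<Sum>j\<in>I. \<Sum>x\<in>?A. (real (r j) - real (y j)) * (of_bool (y(j := y j + 1) = x) * c x))"
      unfolding lower_def by (simp only: sum_distrib_left)
    also have "\<dots> = (\<Sum>x\<in>?A. ?M y x * c x)"
      by (subst sum.swap) (simp only: sum_distrib_right mult.assoc)
    finally show ?thesis using c(2)[of y] True y by simp
  next
    case False
    then show ?thesis using lower_nonzeroD[OF h y] by blast
  qed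
  then have "primitive i p" using h by (simp add: primitive_def zero_on_def)
  moreover have "\<not> zero_on p" using c(1) by (auto simp: zero_on_def p_def)
  ultimately show ?thesis by (rule that)
qed

text \<open>A polynomial of degree at most \<open>i\<close> that continues \<open>p\<close> from
  layer \<open>i\<close> to higher layers as the raised functions divided by factorials.\<close>

definition extend :: "nat \<Rightarrow> (('i \<Rightarrow> nat) \<Rightarrow> real) \<Rightarrow> ('i \<Rightarrow> nat) \<Rightarrow> real" where
  "extend i p x = (\<Sum>a\<in>{a \<in> B. rank a = i}. p a * binom a x)"

lemma extend_below: "rank x < i \<Longrightarrow> extend i p x = 0"
  unfolding extend_def by (intro sum.neutral) (auto dest: binom_nonzeroD(2))

text \<open>For points of \<open>B\<close> of equal rank, \<open>binom a x\<close> is nonzero only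
  if \<open>a = x\<close>, where it is 1.\<close>

lemma extend_same:
  assumes "x \<in> B" "rank x = i" shows "extend i p x = p x"
proof -
  have "binom a x = of_bool (a = x)" if a: "a \<in> B" "rank a = i" for a
  proof (cases "binom a x = 0")
    case True
    then have "a \<noteq> x" using finite_I by (auto simp: binom_def)
    then show ?thesis using True by simp
  next
    case False
    then have le: "\<And>j. j \<in> I \<Longrightarrow> a j \<le> x j" by (rule binom_nonzeroD)
    have "a j = x j" if "j \<in> I" for j
      using sum_mono_inv[of a I x j] le that a assms finite_I by (simp add: rank_def)
    then have "a = x" using a assms unfolding B_def by (intro PiE_ext)
    then show ?thesis by (simp add: binom_def)
  qed
  then have "extend i p x = (\<Sum>a\<in>{a \<in> B. rank a = i}. if a = x then p a else 0)"
    unfolding extend_def by (intro sum.cong) auto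
  also have "\<dots> = p x" using assms finite_B by simp
  finally show ?thesis .
qed

lemma raise_extend: "raise (extend i p) x = (real (rank x) - real i) * extend i p x"
proof -
  have "raise (extend i p) x = (\<Sum>a\<in>{a \<in> B. rank a = i}. p a * raise (binom a) x)"
    unfolding raise_def extend_def
    by (simp only: sum_distrib_left sum.swap[of _ I] mult.left_commute)
  also have "\<dots> = (\<Sum>a\<in>{a \<in> B. rank a = i}. (real (rank x) - real i) * (p a * binom a x))"
    by (intro sum.cong) (auto simp: raise_binom)
  finally show ?thesis by (simp only: extend_def sum_distrib_left)
qed

text \<open>On layer \<open>i + t + 1\<close>, \<open>raise\<close> multiplies the extension by
  \<open>t + 1\<close>, which builds up the factorial.\<close>

lemma raise_funpow_extend:
  "x \<in> B \<Longrightarrow> rank x = i + t \<Longrightarrow> (raise ^^ t) p x = fact t * extend i p x"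
proof (induction t arbitrary: x)
  case 0
  then show ?case by (simp add: extend_same)
next
  case (Suc t)
  have "real (x j) * (raise ^^ t) p (x(j := x j - 1)) =
      real (x j) * (fact t * extend i p (x(j := x j - 1)))" if j: "j \<in> I" for j
  \<comment> \<open>At \<open>x j = 0\<close> the lowered point is \<open>x\<close> itself, on the
    wrong layer for the induction hypothesis, but the factor \<open>x j\<close> vanishes.\<close>
  proof (cases "x j = 0")
    case False
    then have "rank (x(j := x j - 1)) = i + t"
      using rank_upd[OF j, of x "x j - 1"] Suc.prems by simp
    then show ?thesis using Suc B_down j by (simp only:)
  qed simp
  then have "(raise ^^ Suc t) p x = raise (\<lambda>y. fact t * extend i p y) x"
    unfolding funpow.simps comp_apply raise_def[of "(raise ^^ t) p"] raise_def[of "\<lambda>y. fact t * extend i p y"]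
    by (intro sum.cong) auto
  also have "\<dots> = fact (Suc t) * extend i p x"
    using Suc.prems by (simp add: raise_scale raise_extend algebra_simps)
  finally show ?case .
qed

text \<open>Here \<open>rank x - i > N - 2 * i\<close>, past the end of the string of
  \<open>p\<close>.\<close>

lemma extend_primitive_above:
  assumes "primitive i p" "\<not> zero_on p" "x \<in> B" "rank x + i > N"
  shows "extend i p x = 0"
proof -
  have M: "2 * i \<le> N" by (rule primitive_rank_le[OF assms(1,2)])
  have "zero_on ((raise ^^ (rank x - i)) p)"
    using assms(4) M by (intro raise_primitive_zero[OF assms(1,2)]) linarith
  moreover have "rank x = i + (rank x - i)" using assms(4) M by linarith
  ultimately show ?thesis
    using raise_funpow_extend[of x i "rank x - i" p] assms(3) by (simp add: zero_on_def)
qed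

lemma extend_primitive_nonzero:
  assumes "primitive i p" "\<not> zero_on p" "i \<le> w" "w + i \<le> N"
  obtains x where "x \<in> B" "rank x = w" "extend i p x \<noteq> 0"
proof -
  have "\<not> zero_on ((raise ^^ (w - i)) p)"
    using assms by (intro raise_primitive_nonzero) auto
  then obtain x where x: "x \<in> B" "(raise ^^ (w - i)) p x \<noteq> 0" by (auto simp: zero_on_def)
  then have "rank x = i + (w - i)"
    using assms(1) homog_raise_funpow[of i p "w - i"] by (auto simp: homog_def primitive_def)
  then show ?thesis using that x raise_funpow_extend[of x i "w - i" p] assms(3) by auto
qed

end

section \<open>Polynomial functions\<close>

lemma power_binomial_basis: "\<exists>s. \<forall>m x. real x ^ m = (\<Sum>a\<le>m. s m a * real (x choose a))"
proof -
  have "\<exists>s. \<forall>x. real x ^ m = (\<Sum>a\<le>m. s a * real (x choose a))" for m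
  proof (induction m)
    case 0
    show ?case by (intro exI[of _ "\<lambda>_. 1"]) simp
  next
    case (Suc m)
    then obtain s where s: "\<And>x. real x ^ m = (\<Sum>a\<le>m. s a * real (x choose a))" by blast
    \<comment> \<open>By \<open>step\<close> below, \<open>x choose a\<close> receives contributions
      from the indices \<open>a\<close> and \<open>a - 1\<close>. The \<open>if\<close> cuts off
      \<open>s\<close> beyond \<open>m\<close>; at \<open>a = 0\<close> the factor \<open>a\<close>
      removes the truncated \<open>a - 1\<close>.\<close>
    define s' where "s' a = (if a \<le> m then real a * s a else 0) + real a * s (a - 1)" for a
    have "real x ^ Suc m = (\<Sum>a\<le>Suc m. s' a * real (x choose a))" for x
    proof -
      have step: "real x * real (x choose a) =
          real a * real (x choose a) + real (Suc a) * real (x choose Suc a)" for a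
      proof (cases "a \<le> x")
        case True
        have "real ((x - a) * (x choose a)) = real (Suc a * (x choose Suc a))"
          by (simp only: binomial_absorb_comp binomial_absorption)
        then show ?thesis using True by (simp add: of_nat_diff algebra_simps)
      next
        case False then show ?thesis by (simp add: binomial_eq_0)
      qed
      have "real x ^ Suc m = (\<Sum>a\<le>m. s a * (real x * real (x choose a)))"
        by (simp add: s sum_distrib_left mult_ac)
      also have "\<dots> = (\<Sum>a\<le>m. real a * s a * real (x choose a)) +
          (\<Sum>a\<le>m. real (Suc a) * s a * real (x choose Suc a))"
        unfolding step sum.distrib[symmetric] by (intro sum.cong) (auto simp: algebra_simps)
      also have "(\<Sum>a\<le>m. real a * s a * real (x choose a)) =
          (\<Sum>a\<le>Suc m. (if a \<le> m then real a * s a else 0) * real (x choose a))"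
        by simp
      also have "(\<Sum>a\<le>m. real (Suc a) * s a * real (x choose Suc a)) =
          (\<Sum>a\<le>Suc m. real a * s (a - 1) * real (x choose a))"
        by (subst sum.atMost_Suc_shift) simp
      finally show ?thesis by (simp only: s'_def distrib_right sum.distrib)
    qed
    then show ?case by blast
  qed
  then show ?thesis by metis
qed

section \<open>Evaluation, degree and closure properties\<close>

definition eval_monom :: "(nat \<Rightarrow>\<^sub>0 nat) \<Rightarrow> (nat \<Rightarrow> real) \<Rightarrow> real" where
  "eval_monom m x = (\<Prod>i\<in>Poly_Mapping.keys m. x i ^ Poly_Mapping.lookup m i)"

lemma eval_monom_superset:
  "finite S \<Longrightarrow> Poly_Mapping.keys m \<subseteq> S \<Longrightarrow> eval_monom m x = (\<Prod>i\<in>S. x i ^ Poly_Mapping.lookup m i)"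
  unfolding eval_monom_def by (intro prod.mono_neutral_left) (auto simp: in_keys_iff)

lemma monom_degree_superset:
  "finite S \<Longrightarrow> Poly_Mapping.keys m \<subseteq> S \<Longrightarrow> monom_degree m = (\<Sum>i\<in>S. Poly_Mapping.lookup m i)"
  unfolding monom_degree_def by (intro sum.mono_neutral_left) (auto simp: in_keys_iff)

lemma eval_monom_add: "eval_monom (m + m') x = eval_monom m x * eval_monom m' x"
  using keys_add[of m m']
  by (simp add: eval_monom_superset[of "Poly_Mapping.keys m \<union> Poly_Mapping.keys m'"]
      lookup_add power_add prod.distrib)

lemma monom_degree_add: "monom_degree (m + m') = monom_degree m + monom_degree m'"
  using keys_add[of m m']
  by (simp add: monom_degree_superset[of "Poly_Mapping.keys m \<union> Poly_Mapping.keys m'"]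
      lookup_add sum.distrib)

lemma eval_mpoly_superset:
  "finite S \<Longrightarrow> Poly_Mapping.keys P \<subseteq> S \<Longrightarrow>
    eval_mpoly P x = (\<Sum>m\<in>S. Poly_Mapping.lookup P m * eval_monom m x)"
  unfolding eval_mpoly_def eval_monom_def[symmetric]
  by (intro sum.mono_neutral_left) (auto simp: in_keys_iff)

lemma total_degree_le_iff:
  "total_degree P \<le> d \<longleftrightarrow> (\<forall>m\<in>Poly_Mapping.keys P. monom_degree m \<le> d)"
  unfolding total_degree_def by (subst Max_le_iff) auto

text \<open>Lets polynomials be built as functions by closure rules; an upper bound on the degree,
  unlike the exact degree, is preserved by sums.\<close>

definition poly_fun :: "nat \<Rightarrow> nat \<Rightarrow> ((nat \<Rightarrow> real) \<Rightarrow> real) \<Rightarrow> bool" where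
  "poly_fun n d f \<longleftrightarrow>
    (\<exists>P\<in>mpoly_ring n. total_degree P \<le> d \<and> (\<forall>x. eval_mpoly P x = f x))"

lemma poly_fun_monom:
  assumes "Poly_Mapping.keys m \<subseteq> {1..n}" "monom_degree m \<le> d"
  shows "poly_fun n d (\<lambda>x. c * eval_monom m x)"
  unfolding poly_fun_def
proof (intro bexI conjI allI)
  let ?P = "Poly_Mapping.single m c :: real_mpoly"
  have k: "Poly_Mapping.keys ?P \<subseteq> {m}" by simp
  show "?P \<in> mpoly_ring n" using k assms by (auto simp: mpoly_ring_def split: if_splits)
  show "total_degree ?P \<le> d" using k assms by (auto simp: total_degree_le_iff split: if_splits)
  show "eval_mpoly ?P x = c * eval_monom m x" for x
    using eval_mpoly_superset[OF _ k] by simp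
qed

lemma poly_fun_add:
  assumes "poly_fun n d f" "poly_fun n d g"
  shows "poly_fun n d (\<lambda>x. f x + g x)"
proof -
  obtain P Q where P: "P \<in> mpoly_ring n" "total_degree P \<le> d" "\<And>x. eval_mpoly P x = f x"
    and Q: "Q \<in> mpoly_ring n" "total_degree Q \<le> d" "\<And>x. eval_mpoly Q x = g x"
    using assms unfolding poly_fun_def by metis
  have k: "Poly_Mapping.keys (P + Q) \<subseteq> Poly_Mapping.keys P \<union> Poly_Mapping.keys Q"
    by (rule keys_add)
  have "eval_mpoly (P + Q) x = eval_mpoly P x + eval_mpoly Q x" for x
    using k by (simp add: eval_mpoly_superset[of "Poly_Mapping.keys P \<union> Poly_Mapping.keys Q"]
        lookup_add distrib_right sum.distrib)
  moreover have "P + Q \<in> mpoly_ring n" "total_degree (P + Q) \<le> d"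
    using P Q k unfolding mpoly_ring_def total_degree_le_iff by blast+
  ultimately show ?thesis using P Q unfolding poly_fun_def by metis
qed

lemma poly_fun_const: "poly_fun n d (\<lambda>_. c)"
  using poly_fun_monom[of 0 n d c] by (simp add: eval_monom_def monom_degree_def)

lemma poly_fun_var: "i \<in> {1..n} \<Longrightarrow> d \<ge> 1 \<Longrightarrow> poly_fun n d (\<lambda>x. x i)"
  using poly_fun_monom[of "Poly_Mapping.single i 1" n d 1]
  by (simp add: eval_monom_def monom_degree_def)

lemma poly_fun_sum:
  assumes "finite S" "\<And>s. s \<in> S \<Longrightarrow> poly_fun n d (f s)"
  shows "poly_fun n d (\<lambda>x. \<Sum>s\<in>S. f s x)"
  using assms by (induction S rule: finite_induct) (auto intro: poly_fun_const poly_fun_add)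

text \<open>The product is expanded into monomials \<open>m + m'\<close>, which avoids the
  convolution product.\<close>

lemma poly_fun_mult:
  assumes "poly_fun n d f" "poly_fun n e g"
  shows "poly_fun n (d + e) (\<lambda>x. f x * g x)"
proof -
  obtain P Q where P: "P \<in> mpoly_ring n" "total_degree P \<le> d" "\<And>x. eval_mpoly P x = f x"
    and Q: "Q \<in> mpoly_ring n" "total_degree Q \<le> e" "\<And>x. eval_mpoly Q x = g x"
    using assms unfolding poly_fun_def by metis
  have "f x * g x = (\<Sum>m\<in>Poly_Mapping.keys P. \<Sum>m'\<in>Poly_Mapping.keys Q.
      (Poly_Mapping.lookup P m * Poly_Mapping.lookup Q m') * eval_monom (m + m') x)" for x
    unfolding P(3)[symmetric] Q(3)[symmetric] eval_mpoly_def eval_monom_def[symmetric]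
    by (simp add: sum_product eval_monom_add mult_ac)
  moreover have "poly_fun n (d + e) (\<lambda>x. (Poly_Mapping.lookup P m * Poly_Mapping.lookup Q m') *
      eval_monom (m + m') x)" if "m \<in> Poly_Mapping.keys P" "m' \<in> Poly_Mapping.keys Q" for m m'
  proof (rule poly_fun_monom)
    show "Poly_Mapping.keys (m + m') \<subseteq> {1..n}"
      using that P(1) Q(1) keys_add[of m m'] unfolding mpoly_ring_def by blast
    show "monom_degree (m + m') \<le> d + e"
      using that P(2) Q(2) by (auto simp: total_degree_le_iff monom_degree_add add_mono)
  qed
  ultimately show ?thesis by (simp add: poly_fun_sum)
qed

lemma poly_fun_prod:
  assumes "finite S" "\<And>s. s \<in> S \<Longrightarrow> poly_fun n (d s) (f s)"
  shows "poly_fun n (\<Sum>s\<in>S. d s) (\<lambda>x. \<Prod>s\<in>S. f s x)"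
  using assms by (induction S rule: finite_induct) (auto intro: poly_fun_const poly_fun_mult)

text \<open>\<open>gchoose\<close> is polynomial in a real argument and agrees with
  \<open>choose\<close> at grid points.\<close>

lemma poly_fun_gbinomial:
  assumes "i \<in> {1..n}"
  shows "poly_fun n a (\<lambda>x. x i gchoose a)"
proof -
  have "poly_fun n (\<Sum>u\<in>{0..<a}. 1) (\<lambda>x. \<Prod>u\<in>{0..<a}. x i + (- real u))"
    using assms by (intro poly_fun_prod poly_fun_add poly_fun_var poly_fun_const) auto
  from poly_fun_mult[OF poly_fun_const[of n 0 "1 / fact a"] this]
  show ?thesis by (simp add: gbinomial_prod_rev)
qed

section \<open>Covers on uniform grids\<close>

locale uniform_grid =
  fixes n :: nat and k :: "nat \<Rightarrow> nat"

sublocale uniform_grid \<subseteq> box "{1..n}" "\<lambda>i. k i - 1"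
  by unfold_locales simp

context uniform_grid
begin

text \<open>Otherwise \<^term>\<open>{1..n}\<close> is rewritten inside the constants inherited from \<^locale>\<open>box\<close>.\<close>

declare One_nat_def [simp del]

definition point :: "(nat \<Rightarrow> nat) \<Rightarrow> nat \<Rightarrow> real" where
  "point x = (\<lambda>j\<in>{1..n}. real (x j))"

lemma grid_N_eq: "grid_N n k = N"
  by (simp add: grid_N_def N_def)

lemma grid_eq: "grid n k = point ` B"
proof (intro equalityI subsetI)
  fix y assume y: "y \<in> grid n k"
  define x where "x = (\<lambda>j\<in>{1..n}. nat \<lfloor>y j\<rfloor>)"
  have *: "\<exists>a\<le>k j - 1. y j = real a" if "j \<in> {1..n}" for j
    using y that unfolding grid_def by (auto dest!: PiE_mem)
  have "nat \<lfloor>y j\<rfloor> \<le> k j - 1" if "j \<in> {1..n}" for j using *[OF that] by auto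
  then have "x \<in> B" by (auto simp: x_def B_def)
  moreover have "point x = y"
  proof
    fix j show "point x j = y j"
      using *[of j] y by (auto simp: point_def x_def grid_def PiE_def extensional_def)
  qed
  ultimately show "y \<in> point ` B" by blast
next
  fix y assume "y \<in> point ` B"
  then show "y \<in> grid n k" by (fastforce simp: grid_def point_def B_def)
qed

lemma inj_on_point: "inj_on point B"
proof (rule inj_onI)
  fix x y assume xy: "x \<in> B" "y \<in> B" "point x = point y"
  have "x j = y j" if "j \<in> {1..n}" for j
    using fun_cong[OF xy(3), of j] that by (simp add: point_def)
  then show "x = y" using xy unfolding B_def by (intro PiE_ext)
qed

lemma wt_point: "wt n (point x) = real (rank x)"
  by (simp add: wt_def point_def rank_def)

lemma layers_eq: "layers n k E = point ` {x \<in> B. rank x \<in> E}"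
  by (auto simp: layers_def grid_eq wt_point)

lemma card_layer: "card (layers n k {j}) = card {x \<in> B. rank x = j}"
  unfolding layers_eq by (simp add: card_image inj_on_subset[OF inj_on_point])

lemma layers_subset_zeros:
  "layers n k E \<subseteq> zeros_on_grid n k P \<longleftrightarrow>
    (\<forall>x\<in>B. rank x \<in> E \<longrightarrow> eval_mpoly P (point x) = 0)"
  by (auto simp: layers_eq zeros_on_grid_def grid_eq)

text \<open>Expanding powers in the binomial basis yields only exponents \<open>\<alpha>\<close>
  bounded by those of the monomial \<open>m\<close>, so the degree does not grow. The pairs
  \<open>(m, \<alpha>)\<close> keep apart equal \<open>\<alpha>\<close> from different
  monomials.\<close>

lemma eval_mpoly_point:
  assumes P: "P \<in> mpoly_ring n"
  obtains S :: "((nat \<Rightarrow>\<^sub>0 nat) \<times> (nat \<Rightarrow> nat)) set" and c where "finite S"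
    "\<And>s. s \<in> S \<Longrightarrow> rank (snd s) \<le> total_degree P"
    "\<And>x. eval_mpoly P (point x) = (\<Sum>s\<in>S. c s * binom (snd s) x)"
proof -
  obtain b where b: "\<And>m x. real x ^ m = (\<Sum>a\<le>m. b m a * real (x choose a))"
    using power_binomial_basis by blast
  let ?J = "\<lambda>m :: nat \<Rightarrow>\<^sub>0 nat. \<Pi>\<^sub>E j\<in>{1..n}. {..Poly_Mapping.lookup m j}"
  let ?b = "\<lambda>m \<alpha>. \<Prod>j\<in>{1..n}. b (Poly_Mapping.lookup m j) (\<alpha> j)"
  have keys: "Poly_Mapping.keys m \<subseteq> {1..n}" if "m \<in> Poly_Mapping.keys P" for m
    using P that by (auto simp: mpoly_ring_def)
  have fin: "finite (?J m)" for m by (intro finite_PiE) auto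
  have m: "eval_monom m (point x) = (\<Sum>\<alpha>\<in>?J m. ?b m \<alpha> * binom \<alpha> x)"
    if "m \<in> Poly_Mapping.keys P" for m x
  proof -
    have "eval_monom m (point x) = (\<Prod>j\<in>{1..n}. real (x j) ^ Poly_Mapping.lookup m j)"
      using eval_monom_superset[OF _ keys[OF that]] by (simp add: point_def)
    also have "\<dots> = (\<Sum>\<alpha>\<in>?J m. \<Prod>j\<in>{1..n}. b (Poly_Mapping.lookup m j) (\<alpha> j) * real (x j choose \<alpha> j))"
      unfolding b by (rule prod_sum_PiE) auto
    finally show ?thesis by (simp only: prod.distrib binom_def)
  qed
  show ?thesis
  proof (rule that)
    show "finite (Sigma (Poly_Mapping.keys P) ?J)" using fin by (intro finite_SigmaI) auto
    show "rank (snd s) \<le> total_degree P" if "s \<in> Sigma (Poly_Mapping.keys P) ?J" for s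
    proof -
      obtain m \<alpha> where "s = (m, \<alpha>)" by (cases s)
      with that have s: "s = (m, \<alpha>)" "m \<in> Poly_Mapping.keys P" "\<alpha> \<in> ?J m" by blast+
      have "rank \<alpha> \<le> monom_degree m"
        unfolding rank_def monom_degree_superset[OF finite_atLeastAtMost keys[OF s(2)]]
        using s(3) by (intro sum_mono) auto
      also have "\<dots> \<le> total_degree P" using s(2) total_degree_le_iff by blast
      finally show ?thesis using s by simp
    qed
    show "eval_mpoly P (point x) = (\<Sum>s\<in>Sigma (Poly_Mapping.keys P) ?J.
        (Poly_Mapping.lookup P (fst s) * ?b (fst s) (snd s)) * binom (snd s) x)" for x
      unfolding eval_mpoly_def eval_monom_def[symmetric] using fin m
      by (simp add: sum.Sigma sum_distrib_left mult.assoc split_beta cong: sum.cong)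
  qed
qed

section \<open>Degree bounds and construction of covers\<close>

lemma cover_degree_bound:
  assumes "P \<in> mpoly_ring n" "layers n k E \<subseteq> zeros_on_grid n k P"
    and "x \<in> B" "eval_mpoly P (point x) \<noteq> 0"
  obtains i where "i \<le> total_degree P" "i \<le> rank x" "rank x + i \<le> N"
    "card (E \<inter> {i..N - i}) \<le> total_degree P - i"
proof -
  obtain S :: "((nat \<Rightarrow>\<^sub>0 nat) \<times> (nat \<Rightarrow> nat)) set" and c where S: "finite S"
    "\<And>s. s \<in> S \<Longrightarrow> rank (snd s) \<le> total_degree P"
    "\<And>x. eval_mpoly P (point x) = (\<Sum>s\<in>S. c s * binom (snd s) x)"
    by (fact eval_mpoly_point[OF assms(1)])
  show ?thesis
  proof (rule card_vanishing_ranks[where f = "\<lambda>x. eval_mpoly P (point x)" and a = snd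
        and S = S and d = "total_degree P" and c = c and E = E and y = x])
    show "eval_mpoly P (point z) = 0" if "z \<in> B" "rank z \<in> E" for z
      using assms(2) layers_subset_zeros that by blast
  qed (use S assms(3,4) that in auto)
qed

text \<open>Layer sizes increase strictly up to the middle; for \<open>i = 0\<close> the origin
  makes the layer nonempty.\<close>

lemma exists_primitive_of_strictly_unimodal:
  assumes "strictly_unimodal n k" "2 * i \<le> N"
  obtains p where "primitive i p" "\<not> zero_on p"
proof -
  have "card {x \<in> B. Suc (rank x) = i} < card {x \<in> B. rank x = i}"
  proof (cases i)
    case 0
    have "(\<lambda>j\<in>{1..n}. 0) \<in> {x \<in> B. rank x = 0}" by (auto simp: B_def rank_def)
    then have "card {x \<in> B. rank x = 0} > 0" using finite_B by (auto simp: card_gt_0_iff)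
    then show ?thesis using 0 by simp
  next
    case (Suc i')
    then have "i' < N div 2" using assms(2) by linarith
    then have "card (layers n k {i'}) < card (layers n k {i' + 1})"
      using assms(1) by (simp add: strictly_unimodal_def Let_def grid_N_eq)
    then show ?thesis using Suc by (simp add: card_layer Suc_eq_plus1)
  qed
  then show ?thesis using exists_primitive that by blast
qed

text \<open>Extending a primitive function of weight \<open>i\<close> covers \<open>T N i\<close>
  with degree \<open>i\<close>; each weight in \<open>F\<close> costs one linear factor.\<close>

lemma exists_cover:
  assumes "strictly_unimodal n k" "2 * i \<le> N" "finite F"
  obtains P where "P \<in> mpoly_ring n" "total_degree P \<le> i + card F"
    "layers n k (T N i \<union> F) \<subseteq> zeros_on_grid n k P"
    "\<And>j. j \<in> {0..N} - T N i - F \<Longrightarrow> \<not> layers n k {j} \<subseteq> zeros_on_grid n k P"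
proof -
  obtain p where p: "primitive i p" "\<not> zero_on p"
    using exists_primitive_of_strictly_unimodal assms by blast
  define f where "f x = (\<Sum>a\<in>{a \<in> B. rank a = i}. p a * (\<Prod>j\<in>{1..n}. x j gchoose a j)) *
      (\<Prod>e\<in>F. (\<Sum>j\<in>{1..n}. x j) + (- real e))" for x :: "nat \<Rightarrow> real"
  have "poly_fun n (i + (\<Sum>e\<in>F. 1)) f"
    unfolding f_def
  proof (intro poly_fun_mult poly_fun_prod poly_fun_add poly_fun_sum poly_fun_var poly_fun_const assms(3))
    show "finite {a \<in> B. rank a = i}" using finite_B by simp
    fix a assume "a \<in> {a \<in> B. rank a = i}"
    \<comment> \<open>The \<open>0 +\<close> splits the degree between the constant
      \<open>p a\<close> and the product, as \<open>poly_fun_mult\<close> requires.\<close>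
    then have i: "i = 0 + (\<Sum>j\<in>{1..n}. a j)" by (simp add: rank_def)
    show "poly_fun n i (\<lambda>x. p a * (\<Prod>j\<in>{1..n}. x j gchoose a j))"
      unfolding i by (intro poly_fun_mult poly_fun_const poly_fun_prod poly_fun_gbinomial) auto
  qed auto
  then obtain P where P: "P \<in> mpoly_ring n" "total_degree P \<le> i + card F" "\<And>x. eval_mpoly P x = f x"
    unfolding poly_fun_def by auto
  have ev: "eval_mpoly P (point x) = extend i p x * (\<Prod>e\<in>F. real (rank x) - real e)" for x
    by (simp add: P(3) f_def extend_def binom_def point_def rank_def binomial_gbinomial)
  show ?thesis
  proof (rule that[OF P(1,2)])
    show "layers n k (T N i \<union> F) \<subseteq> zeros_on_grid n k P"
      unfolding layers_subset_zeros
    proof (intro ballI impI)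
      fix x assume x: "x \<in> B" "rank x \<in> T N i \<union> F"
      show "eval_mpoly P (point x) = 0"
      proof (cases "rank x \<in> F")
        case True
        then show ?thesis using assms(3) by (auto simp: ev prod_zero_iff)
      next
        case False
        then have "rank x < i \<or> rank x + i > N" using x(2) by (auto simp: T_def)
        then show ?thesis
          using extend_below[of x i p] extend_primitive_above[OF p x(1)] by (auto simp: ev)
      qed
    qed
    fix j assume j: "j \<in> {0..N} - T N i - F"
    then have "i \<le> j" "j + i \<le> N" by (auto simp: T_def)
    then obtain x where x: "x \<in> B" "rank x = j" "extend i p x \<noteq> 0"
      using extend_primitive_nonzero[OF p] by blast
    then have "eval_mpoly P (point x) \<noteq> 0" using j assms(3) by (auto simp: ev prod_zero_iff)
    then show "\<not> layers n k {j} \<subseteq> zeros_on_grid n k P"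
      using x by (auto simp: layers_subset_zeros)
  qed
qed

lemma minus_T: "E \<subseteq> {0..N} \<Longrightarrow> E - T N i = E \<inter> {i..N - i}"
  by (auto simp: T_def)

lemma T_subset: "i \<le> N \<Longrightarrow> T N i \<subseteq> {0..N}"
  by (auto simp: T_def)

lemma T_mono: "i \<le> j \<Longrightarrow> j \<le> N \<Longrightarrow> T N i \<subseteq> T N j"
  by (auto simp: T_def)

lemma card_T: "2 * i \<le> N \<Longrightarrow> card (T N i) = 2 * i"
  unfolding T_def by (subst card_Un_disjoint) auto

lemma T_Suc: "2 * Suc i \<le> N \<Longrightarrow> T N (Suc i) = insert i (insert (N - i) (T N i))"
  by (auto simp: T_def)

section \<open>The minimum degrees of nontrivial and proper covers\<close>

text \<open>The rank of a point where \<open>P\<close> is nonzero lies outside \<open>E\<close>, and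
  outside \<open>T N i\<close> by the bounds of \<open>cover_degree_bound\<close>.\<close>

lemma nontrivial_cover_admitting:
  assumes "nontrivial_cover n k E P" "E \<subseteq> {0..N}"
  shows "d_admitting N (total_degree P) E"
proof -
  have P: "P \<in> mpoly_ring n" "layers n k E \<subseteq> zeros_on_grid n k P"
    "zeros_on_grid n k P \<noteq> grid n k"
    using assms(1) by (auto simp: nontrivial_cover_def)
  obtain x where x: "x \<in> B" "eval_mpoly P (point x) \<noteq> 0"
    using P(3) by (auto simp: zeros_on_grid_def grid_eq)
  obtain i where i: "i \<le> total_degree P" "i \<le> rank x" "rank x + i \<le> N"
    "card (E \<inter> {i..N - i}) \<le> total_degree P - i"
    using cover_degree_bound[OF P(1,2) x] by metis
  have "rank x \<notin> E" using P(2) x layers_subset_zeros by blast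
  moreover have "rank x \<notin> T N i" "rank x \<in> {0..N}" using i by (auto simp: T_def)
  ultimately have "E \<union> T N i \<noteq> {0..N}" by blast
  then show ?thesis
    using i minus_T[OF assms(2)] by (auto simp: d_admitting_def di_admitting_def)
qed

text \<open>Existence of a cover is included so that the \<open>LEAST\<close> in \<open>PC\<close>
  is known to be attained.\<close>

lemma PC_le_admitting:
  assumes "strictly_unimodal n k" "E \<subset> {0..N}" "d \<le> N" "d_admitting N d E"
  shows "(\<exists>P. nontrivial_cover n k E P) \<and> PC n k E \<le> d"
proof -
  obtain i where i: "i \<le> d" "E \<union> T N i \<noteq> {0..N}" "card (E - T N i) \<le> d - i"
    using assms(4) unfolding d_admitting_def di_admitting_def by blast
  have TN: "T N i \<subseteq> {0..N}" using i assms by (intro T_subset) simp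
  then obtain j where j: "j \<in> {0..N}" "j \<notin> E" "j \<notin> T N i" using assms(2) i(2) by blast
  \<comment> \<open>The missed weight \<open>j\<close> satisfies
    \<open>i \<le> j \<le> N - i\<close>, so a primitive function of weight \<open>i\<close> is
    available.\<close>
  then have "2 * i \<le> N" by (auto simp: T_def)
  moreover have "finite (E - T N i)" using assms(2) by (auto intro: finite_subset)
  ultimately obtain P where P: "P \<in> mpoly_ring n" "total_degree P \<le> i + card (E - T N i)"
    "layers n k (T N i \<union> (E - T N i)) \<subseteq> zeros_on_grid n k P"
    "\<And>j. j \<in> {0..N} - T N i - (E - T N i) \<Longrightarrow> \<not> layers n k {j} \<subseteq> zeros_on_grid n k P"
    using exists_cover[OF assms(1)] by metis
  have "layers n k E \<subseteq> zeros_on_grid n k P" using P(3) by (auto simp: layers_def)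
  moreover have "\<not> layers n k {j} \<subseteq> zeros_on_grid n k P" using P(4) j by blast
  then have "zeros_on_grid n k P \<noteq> grid n k" by (auto simp: layers_def)
  ultimately have c: "nontrivial_cover n k E P" using P(1) by (simp add: nontrivial_cover_def)
  then have "PC n k E \<le> total_degree P" unfolding PC_def by (intro Least_le) blast
  then show ?thesis using c P(2) i by auto
qed

lemma PC_eq:
  assumes "strictly_unimodal n k" "E \<subset> {0..N}"
  shows "PC n k E = Min {d \<in> {0..N}. d_admitting N d E}"
proof -
  have "card E < card {0..N}" using assms(2) by (intro psubset_card_mono) auto
  then have cE: "card E \<le> N" by simp
  \<comment> \<open>The witness is \<open>i = 0\<close>, as \<open>T N 0\<close> is empty; hence the
    minimum ranges over a nonempty set.\<close>
  have "d_admitting N (card E) E"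
    using assms(2) by (auto simp: d_admitting_def di_admitting_def T_def intro!: bexI[of _ 0])
  note ub = PC_le_admitting[OF assms cE this]
  then have "\<exists>d P. nontrivial_cover n k E P \<and> total_degree P = d" by blast
  from LeastI_ex[OF this] obtain P where "nontrivial_cover n k E P" "total_degree P = PC n k E"
    unfolding PC_def by blast
  then have "d_admitting N (PC n k E) E" using nontrivial_cover_admitting assms(2) by fastforce
  then show ?thesis
    using PC_le_admitting[OF assms] ub cE by (intro Min_eqI[symmetric]) auto
qed

lemma PPC_eq:
  assumes "strictly_unimodal n k" "E \<subset> {0..N}"
  shows "int (PPC n k E) = int (card E) - int (Max {i \<in> {0..N div 2}. T N i \<subseteq> E})"
proof -
  let ?A = "{i \<in> {0..N div 2}. T N i \<subseteq> E}"
  define m where "m = Max ?A"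
  have "0 \<in> ?A" by (auto simp: T_def)
  then have "m \<in> ?A" unfolding m_def by (intro Max_in) auto
  then have m: "2 * m \<le> N" "T N m \<subseteq> E" by auto
  have m_max: "i \<le> m" if "i \<in> ?A" for i unfolding m_def using that by (intro Max_ge) auto
  have fE: "finite E" using assms(2) by (auto intro: finite_subset)
  \<comment> \<open>\<open>T N i\<close> removes \<open>2 * i\<close> elements of \<open>E\<close>
    at degree \<open>i\<close>, a saving of \<open>i\<close>, so \<open>i = m\<close> gives the
    cover below.\<close>
  have card_minus: "card (E - T N i) + 2 * i = card E" if "i \<le> m" for i
  proof -
    have "T N i \<subseteq> E" using T_mono[OF that] m by auto
    then show ?thesis
      using card_T[of i] that m(1) fE card_mono[of E "T N i"]
      by (simp add: card_Diff_subset finite_subset)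
  qed
  obtain P where P: "P \<in> mpoly_ring n" "total_degree P \<le> m + card (E - T N m)"
    "layers n k (T N m \<union> (E - T N m)) \<subseteq> zeros_on_grid n k P"
    "\<And>j. j \<in> {0..N} - T N m - (E - T N m) \<Longrightarrow> \<not> layers n k {j} \<subseteq> zeros_on_grid n k P"
    using exists_cover[OF assms(1) m(1), of "E - T N m"] fE by blast
  have "layers n k E \<subseteq> zeros_on_grid n k P" using P(3) by (auto simp: layers_def)
  moreover have "\<not> layers n k {j} \<subseteq> zeros_on_grid n k P" if "j \<in> {0..N} - E" for j
    using P(4)[of j] that m(2) by blast
  ultimately have c: "proper_cover n k E P" using P(1) by (simp add: proper_cover_def grid_N_eq)
  then have "PPC n k E \<le> total_degree P" unfolding PPC_def by (intro Least_le) blast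
  also have "\<dots> + m \<le> card E" using P(2) card_minus[of m] by simp
  finally have upper: "PPC n k E + m \<le> card E" by simp
  have "\<exists>d P. proper_cover n k E P \<and> total_degree P = d" using c by blast
  from LeastI_ex[OF this] obtain Q where Q: "proper_cover n k E Q" "total_degree Q = PPC n k E"
    unfolding PPC_def by blast
  \<comment> \<open>By maximality of \<open>m\<close>, either \<open>m\<close> or
    \<open>N - m\<close> is missing from \<open>E\<close>; if \<open>m = N div 2\<close>, any
    missing weight is this close to an end.\<close>
  obtain j where j: "j \<in> {0..N}" "j \<notin> E" "min j (N - j) \<le> m"
  proof (cases "2 * Suc m \<le> N")
    case True
    then have "Suc m \<notin> ?A" using m_max[of "Suc m"] by auto
    then have "\<not> T N (Suc m) \<subseteq> E" using True by auto
    then have "m \<notin> E \<or> N - m \<notin> E" using T_Suc[OF True] m(2) by auto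
    then show ?thesis using that[of m] that[of "N - m"] m(1) by auto
  next
    case False
    obtain j where "j \<in> {0..N}" "j \<notin> E" using assms(2) by blast
    then show ?thesis using False by (intro that[of j]) auto
  qed
  have Q': "Q \<in> mpoly_ring n" "layers n k E \<subseteq> zeros_on_grid n k Q"
    "\<not> layers n k {j} \<subseteq> zeros_on_grid n k Q"
    using Q(1) j by (auto simp: proper_cover_def grid_N_eq)
  then obtain x where x: "x \<in> B" "rank x = j" "eval_mpoly Q (point x) \<noteq> 0"
    by (auto simp: layers_subset_zeros)
  obtain i where i: "i \<le> total_degree Q" "i \<le> j" "j + i \<le> N"
    "card (E \<inter> {i..N - i}) \<le> total_degree Q - i"
    using cover_degree_bound[OF Q'(1,2) x(1,3)] x(2) by metis
  \<comment> \<open>As \<open>i \<le> min j (N - j)\<close>, \<open>card_minus\<close> applies and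
    the bound reads \<open>card E - 2 * i \<le> PPC n k E - i\<close>.\<close>
  have "i \<le> m" using i j(3) by linarith
  moreover have "card (E - T N i) \<le> PPC n k E - i"
    using i(4) minus_T[of E i] assms(2) Q(2) by auto
  ultimately have "card E \<le> PPC n k E + m" using card_minus[of i] i(1) Q(2) by linarith
  with upper show ?thesis unfolding m_def by linarith
qed

end

theorem theorem1p4:
  fixes n :: nat and k :: "nat \<Rightarrow> nat" and E :: "nat set"
  assumes "n \<ge> 1"
    and "\<forall>i\<in>{1..n}. k i \<ge> 2"
    and "strictly_unimodal n k"
    and "E \<subset> {0..grid_N n k}"
  shows "PC n k E = Min {d \<in> {0..grid_N n k}. d_admitting (grid_N n k) d E} \<and>
         int (PPC n k E) =
           int (card E) - int (Max {i \<in> {0..grid_N n k div 2}. T (grid_N n k) i \<subseteq> E})"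
proof -
  interpret uniform_grid n k .
  show ?thesis using PC_eq PPC_eq assms(3,4) by (simp only: grid_N_eq)
qed

end
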